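(* Let $A=(a_k)_{k\in\mathbb{Z}}$, where $a_k\le a_{k+1}$ for all $k\in\mathbb{Z}$, be an almost periodic multiple discrete set in $\mathbb{R}$ with density $D$. Then there is an almost periodic function $f$ on $\mathbb{R}$ such that $$a_k=\frac{k}{D}+f(k)\qquad\text{for all }k\in\mathbb{Z}.$$
   Context: A continuous function $f$ on $\mathbb{R}$ is almost periodic if for every $\varepsilon>0$ the set $\{\tau\in\mathbb{R}:\sup_{x\in\mathbb{R}}|f(x+\tau)-f(x)|<\varepsilon\}$ is relatively dense in $\mathbb{R}$, i.e. there is $R=R(\varepsilon)<\infty$ such that every interval $(c-R,c+R)$ contains an element of this set. A Borel measure $\mu$ on $\mathbb{R}$ is almost periodic (in the weak sense) if for every continuous compactly supported function $\varphi$ on $\mathbb{R}$ the function $x\mapsto\int\varphi(x+t)\,d\mu(t)$ is almost periodic on $\mathbb{R}$. A multiple discrete set $A=\{(x,m(x))\}$ in $\mathbb{R}$ is a discrete (locally finite) set $s(A)\subset\mathbb{R}$ together with a multiplicity $m(x)\in\mathbb{N}=\{1,2,\dots\}$ for each $x\in s(A)$. It is also written as an indexed family $A=(a_k)$ in which every $a\in s(A)$ appears exactly $m(a)$ times. $A$ is called almost periodic if its associated measure $\mu_A=\sum_{x\in s(A)}m(x)\delta_x$ is almost periodic, where $\delta_x$ is the unit mass at $x$. For $E\subset\mathbb{R}$ put $\mathrm{card}(A\cap E)=\sum_{x\in s(A)\cap E}m(x)$. The density of an almost periodic multiple discrete set $A$ in $\mathbb{R}$ is the limit $$D=D(A)=\lim_{R\to\infty}\frac{\mathrm{card}(A\cap(x-R,x+R))}{2R},$$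 which is known to exist, be finite, and be uniform in $x\in\mathbb{R}$. *)

theory Defs
  imports "HOL-Analysis.Analysis"
begin

definition relatively_dense :: "real set \<Rightarrow> bool" where
  "relatively_dense S \<longleftrightarrow> (\<exists>R. \<forall>c. S \<inter> {c - R<..<c + R} \<noteq> {})"

text \<open>The supremum is taken in the extended reals, since on the reals \<open>SUP\<close> is unspecified for
  unbounded families.\<close>

definition almost_periodic :: "(real \<Rightarrow> real) \<Rightarrow> bool" where
  "almost_periodic f \<longleftrightarrow>
     continuous_on UNIV f \<and>
     (\<forall>\<epsilon>>0. relatively_dense {\<tau>. (SUP x. ereal \<bar>f (x + \<tau>) - f x\<bar>) < ereal \<epsilon>})"

definition compactly_supported :: "(real \<Rightarrow> real) \<Rightarrow> bool" where
  "compactly_supported \<phi> \<longleftrightarrow> compact (closure {x. \<phi> x \<noteq> 0})"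

text \<open>Finiteness on compact sets makes all the integrals below exist; a non-integrable function
  would have Bochner integral 0 by convention.\<close>

definition almost_periodic_measure :: "real measure \<Rightarrow> bool" where
  "almost_periodic_measure \<mu> \<longleftrightarrow>
     sets \<mu> = sets borel \<and>
     (\<forall>K. compact K \<longrightarrow> emeasure \<mu> K < \<infinity>) \<and>
     (\<forall>\<phi>. continuous_on UNIV \<phi> \<and> compactly_supported \<phi> \<longrightarrow>
        almost_periodic (\<lambda>x. \<integral>t. \<phi> (x + t) \<partial>\<mu>))"

text \<open>A multiple discrete set is encoded by its multiplicity function, extended by 0 outside of
  the underlying set \<open>s(A)\<close>.\<close>

definition mds_support :: "(real \<Rightarrow> nat) \<Rightarrow> real set" where
  "mds_support A = {x. A x \<noteq> 0}"

definition multiple_discrete_set :: "(real \<Rightarrow> nat) \<Rightarrow> bool" where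
  "multiple_discrete_set A \<longleftrightarrow> (\<forall>B. bounded B \<longrightarrow> finite (mds_support A \<inter> B))"

text \<open>Finiteness of the fibres is stated separately because \<open>card\<close> of an infinite set is 0.\<close>

definition enumerates :: "(int \<Rightarrow> real) \<Rightarrow> (real \<Rightarrow> nat) \<Rightarrow> bool" where
  "enumerates a A \<longleftrightarrow> (\<forall>x. finite {k. a k = x} \<and> card {k. a k = x} = A x)"

text \<open>The measure \<open>\<Sum>x\<in>s(A). m(x) \<delta>\<^sub>x\<close>, as the image on the Borel sets of the weighted counting
  measure on \<open>s(A)\<close>; see \<open>emeasure_mds_measure\<close>.\<close>

definition mds_measure :: "(real \<Rightarrow> nat) \<Rightarrow> real measure" where
  "mds_measure A =
     distr (density (count_space (mds_support A)) (\<lambda>x. of_nat (A x))) borel (\<lambda>x. x)"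

lemma emeasure_mds_measure:
  assumes "E \<in> sets borel"
  shows "emeasure (mds_measure A) E =
    (\<integral>\<^sup>+x. of_nat (A x) * indicator E x \<partial>count_space (mds_support A))"
  using assms unfolding mds_measure_def
  by (subst emeasure_distr)
     (auto simp: emeasure_density intro!: nn_integral_cong split: split_indicator)

definition almost_periodic_mds :: "(real \<Rightarrow> nat) \<Rightarrow> bool" where
  "almost_periodic_mds A \<longleftrightarrow>
     multiple_discrete_set A \<and> almost_periodic_measure (mds_measure A)"

definition mds_card :: "(real \<Rightarrow> nat) \<Rightarrow> real set \<Rightarrow> nat" where
  "mds_card A E = (\<Sum>x\<in>mds_support A \<inter> E. A x)"

definition mds_density :: "(real \<Rightarrow> nat) \<Rightarrow> real" where
  "mds_density A =
     (THE D. \<forall>x. ((\<lambda>R. real (mds_card A {x - R<..<x + R}) / (2 * R)) \<longlongrightarrow> D) at_top)"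

end

theory Submission imports Defs begin

text \<open>The sum of a narrow tent function over the points of \<open>A\<close> is almost periodic. If \<open>\<tau>\<close> is an almost
  period of it, then \<open>A\<close> and \<open>A + \<tau>\<close> have the same number of points between any two gaps common to
  both. Since \<open>A\<close> has boundedly many points per unit interval, such gaps occur with small spacing,
  so there is an integer \<open>h\<close> with \<open>\<bar>a (k + h) - a k - \<tau>\<bar> \<le> \<epsilon>\<close> for all \<open>k\<close>. Iterating such
  translations gives a slope \<open>L > 0\<close> with \<open>\<bar>\<tau> - h L\<bar> \<le> \<epsilon>\<close>, so \<open>h\<close> is a \<open>2\<epsilon>\<close>-almost period of
  \<open>k \<mapsto> a k - k L\<close>. This sequence is therefore almost periodic on the integers, in particular bounded,
  which yields \<open>D = 1 / L\<close>; its piecewise linear interpolation is the required function.\<close>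

section \<open>Passing between the multiple discrete set and its enumeration\<close>

lemma sum_enumerates:
  fixes \<psi> :: "real \<Rightarrow> real"
  assumes "enumerates a A" "finite X"
  shows "(\<Sum>x\<in>X. real (A x) * \<psi> x) = (\<Sum>k\<in>{k. a k \<in> X}. \<psi> (a k))"
proof -
  have fib: "finite {k. a k = x}" "card {k. a k = x} = A x" for x
    using assms(1) by (auto simp: enumerates_def)
  have "{k. a k \<in> X} = (\<Union>x\<in>X. {k. a k = x})" by auto
  hence "(\<Sum>k\<in>{k. a k \<in> X}. \<psi> (a k)) = (\<Sum>x\<in>X. \<Sum>k\<in>{k. a k = x}. \<psi> (a k))"
    using assms(2) fib by (simp only:) (rule sum.UNION_disjoint, auto)
  also have "\<dots> = (\<Sum>x\<in>X. real (A x) * \<psi> x)"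
    by (rule sum.cong) (auto simp: fib(2)[symmetric])
  finally show ?thesis ..
qed

lemma enumerates_in_support:
  assumes "enumerates a A"
  shows "a k \<in> mds_support A"
proof -
  have "finite {j. a j = a k}" "card {j. a j = a k} = A (a k)"
    using assms by (auto simp: enumerates_def)
  hence "A (a k) \<noteq> 0" by (metis (mono_tags, lifting) card_0_eq empty_Collect_eq)
  thus ?thesis by (simp add: mds_support_def)
qed

lemma finite_enumerates_bounded:
  assumes "multiple_discrete_set A" "enumerates a A" "bounded B"
  shows "finite {k. a k \<in> B}"
proof -
  have "{k. a k \<in> B} = (\<Union>x\<in>mds_support A \<inter> B. {k. a k = x})"
    using enumerates_in_support[OF assms(2)] by auto
  thus ?thesis
    using assms by (auto simp: enumerates_def multiple_discrete_set_def)
qed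

lemma mds_card_enumerates:
  assumes "multiple_discrete_set A" "enumerates a A" "bounded B"
  shows "mds_card A B = card {k. a k \<in> B}"
proof -
  have "finite (mds_support A \<inter> B)" using assms by (simp add: multiple_discrete_set_def)
  from sum_enumerates[OF assms(2) this, of "\<lambda>_. 1"]
  have "real (mds_card A B) = real (card {k. a k \<in> mds_support A \<inter> B})"
    by (simp add: mds_card_def)
  thus ?thesis using enumerates_in_support[OF assms(2)] by simp
qed

lemma integral_mds_measure:
  fixes \<psi> :: "real \<Rightarrow> real"
  assumes "multiple_discrete_set A" "enumerates a A"
    and "\<psi> \<in> borel_measurable borel" "bounded {t. \<psi> t \<noteq> 0}"
    and "finite I" "\<And>k. \<psi> (a k) \<noteq> 0 \<Longrightarrow> k \<in> I"
  shows "(\<integral>t. \<psi> t \<partial>mds_measure A) = (\<Sum>k\<in>I. \<psi> (a k))"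
proof -
  let ?X = "mds_support A \<inter> {t. \<psi> t \<noteq> 0}"
  have fin: "finite ?X" using assms by (simp add: multiple_discrete_set_def)
  have eq: "{x \<in> mds_support A. real (A x) * \<psi> x \<noteq> 0} = ?X"
    by (auto simp: mds_support_def)
  have "(\<integral>t. \<psi> t \<partial>mds_measure A)
      = (\<integral>t. \<psi> t \<partial>density (count_space (mds_support A)) (\<lambda>x. ennreal (real (A x))))"
    unfolding mds_measure_def using assms(3)
    by (subst integral_distr) (auto simp: ennreal_of_nat_eq_real_of_nat)
  also have "\<dots> = (\<integral>t. real (A t) * \<psi> t \<partial>count_space (mds_support A))"
    by (subst integral_density) auto
  also have "\<dots> = (\<Sum>x\<in>?X. real (A x) * \<psi> x)"
    using fin unfolding eq[symmetric] by (rule lebesgue_integral_count_space_finite_support)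
  also have "\<dots> = (\<Sum>k\<in>{k. a k \<in> ?X}. \<psi> (a k))"
    by (rule sum_enumerates[OF assms(2) fin])
  also have "\<dots> = (\<Sum>k\<in>I. \<psi> (a k))"
    using assms(5,6) enumerates_in_support[OF assms(2)]
    by (intro sum.mono_neutral_left) auto
  finally show ?thesis .
qed

section \<open>Tent functions as differences of ramps\<close>

definition tent :: "real \<Rightarrow> real \<Rightarrow> real" where
  "tent \<delta> s = max 0 (1 - \<bar>s\<bar> / \<delta>)"

text \<open>A continuous substitute for the Heaviside step, rising over one cell of length
  \<delta>.\<close>

definition ramp :: "real \<Rightarrow> real \<Rightarrow> real" where
  "ramp \<delta> s = max 0 (min 1 (s / \<delta>))"

lemma tent_eq_0: "0 < \<delta> \<Longrightarrow> \<delta> \<le> \<bar>s\<bar> \<Longrightarrow> tent \<delta> s = 0"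
  by (simp add: tent_def field_simps)

lemma tent_nonneg: "0 \<le> tent \<delta> s"
  by (simp add: tent_def)

lemma continuous_on_tent [continuous_intros]:
  "continuous_on S f \<Longrightarrow> continuous_on S (\<lambda>x. tent \<delta> (f x))"
  \<comment> \<open>Division by zero yields 0, so the tent for \<delta> = 0 is constantly 1;
    continuity of the quotient covers the other case.\<close>
  by (cases "\<delta> = 0") (simp_all add: tent_def continuous_intros)

lemma compactly_supported_tent:
  assumes "0 < \<delta>"
  shows "compactly_supported (tent \<delta>)"
proof -
  have "{s. tent \<delta> s \<noteq> 0} \<subseteq> {-\<delta>..\<delta>}" 
  proof
    fix s assume "s \<in> {s. tent \<delta> s \<noteq> 0}"
    thus "s \<in> {-\<delta>..\<delta>}" using tent_eq_0[OF assms, of s] by (cases "\<delta> \<le> \<bar>s\<bar>") auto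
  qed
  hence "bounded {s. tent \<delta> s \<noteq> 0}" by (rule bounded_subset[OF bounded_closed_interval])
  thus ?thesis by (simp add: compactly_supported_def)
qed

text \<open>The ramp starting one cell earlier supplies the rising flank; subtracting the ramp that
  starts at the peak supplies the falling one.\<close>

lemma tent_eq_ramp_diff:
  assumes "0 < \<delta>"
  shows "tent \<delta> (s - of_int j * \<delta>) = ramp \<delta> (s - of_int (j - 1) * \<delta>) - ramp \<delta> (s - of_int j * \<delta>)"
proof -
  have "(s - of_int (j - 1) * \<delta>) / \<delta> = (s - of_int j * \<delta>) / \<delta> + 1"
    using assms by (simp add: field_simps)
  moreover have "\<bar>s - of_int j * \<delta>\<bar> / \<delta> = \<bar>(s - of_int j * \<delta>) / \<delta>\<bar>"
    using assms by simp
  ultimately show ?thesis unfolding tent_def ramp_def by (simp add: max_def min_def abs_if)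
qed

text \<open>The sum is a trapezoid: 1 from \<open>(m + 1) * \<delta>\<close> to
  \<open>n * \<delta>\<close>, and 0 outside the cells \<open>m\<close> to \<open>n\<close>. Only
  cells \<open>m\<close> and \<open>n\<close> see fractional values.\<close>

lemma sum_tent_telescope:
  assumes "0 < \<delta>" "m \<le> n"
  shows "(\<Sum>j\<in>{m<..n}. tent \<delta> (s - of_int j * \<delta>)) = ramp \<delta> (s - of_int m * \<delta>) - ramp \<delta> (s - of_int n * \<delta>)"
  using assms(2)
proof (induction n rule: int_ge_induct)
  case (step i)
  have "{m<..i + 1} = insert (i + 1) {m<..i}" using step.hyps by auto
  thus ?case using step.IH tent_eq_ramp_diff[OF assms(1), of s "i + 1"] by simp
qed simp

text \<open>The excluded cell is half-open because ramp and step disagree at 0 but agree at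
  \<delta>.\<close>

lemma ramp_outside:
  assumes "0 < \<delta>" "s \<notin> {0..<\<delta>}"
  shows "ramp \<delta> s = of_bool (0 \<le> s)"
  using assms by (auto simp: ramp_def field_simps max_def min_def)

section \<open>Almost periodic functions\<close>

lemma almost_periodD:
  assumes "(SUP x. ereal \<bar>f (x + \<tau>) - f x\<bar>) < ereal \<epsilon>"
  shows "\<bar>f (x + \<tau>) - f x\<bar> < \<epsilon>"
proof -
  have "ereal \<bar>f (x + \<tau>) - f x\<bar> \<le> (SUP x. ereal \<bar>f (x + \<tau>) - f x\<bar>)"
    by (rule SUP_upper) simp
  thus ?thesis using assms by (metis le_less_trans less_ereal.simps(1))
qed

lemma almost_periodicD:
  assumes "almost_periodic f" "0 < \<epsilon>"
  obtains R where "\<And>c. \<exists>\<tau>. \<bar>\<tau> - c\<bar> < R \<and> (\<forall>x. \<bar>f (x + \<tau>) - f x\<bar> < \<epsilon>)"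
proof -
  obtain R where R: "\<And>c. {\<tau>. (SUP x. ereal \<bar>f (x + \<tau>) - f x\<bar>) < ereal \<epsilon>} \<inter> {c - R<..<c + R} \<noteq> {}"
    using assms unfolding almost_periodic_def relatively_dense_def by blast
  show ?thesis
  proof (rule that[of R])
    fix c
    from R[of c] obtain \<tau> where "(SUP x. ereal \<bar>f (x + \<tau>) - f x\<bar>) < ereal \<epsilon>" "\<tau> \<in> {c - R<..<c + R}"
      by blast
    moreover from this(2) have "\<bar>\<tau> - c\<bar> < R" by (simp add: abs_less_iff)
    ultimately show "\<exists>\<tau>. \<bar>\<tau> - c\<bar> < R \<and> (\<forall>x. \<bar>f (x + \<tau>) - f x\<bar> < \<epsilon>)"
      using almost_periodD by blast
  qed
qed

text \<open>An almost period near \<open>-x\<close> carries \<open>x\<close> into the compact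
  interval from \<open>-R\<close> to \<open>R\<close>, where continuity bounds \<open>f\<close>; the
  move costs less than 1.\<close>

lemma almost_periodic_bounded:
  assumes "almost_periodic f"
  obtains B where "\<And>x. \<bar>f x\<bar> \<le> B"
proof -
  obtain R where R: "\<And>c. \<exists>\<tau>. \<bar>\<tau> - c\<bar> < R \<and> (\<forall>x. \<bar>f (x + \<tau>) - f x\<bar> < 1)"
    using almost_periodicD[OF assms zero_less_one] by blast
  have "continuous_on {-R..R} f"
    using assms continuous_on_subset unfolding almost_periodic_def by blast
  hence "bounded (f ` {-R..R})"
    using compact_continuous_image compact_imp_bounded by blast
  then obtain B where B: "\<And>x. x \<in> {-R..R} \<Longrightarrow> \<bar>f x\<bar> \<le> B"
    unfolding bounded_iff by (metis imageI real_norm_def)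
  show ?thesis
  proof (rule that[of "B + 1"])
    fix x
    obtain \<tau> where \<tau>: "\<bar>\<tau> - (-x)\<bar> < R" "\<bar>f (x + \<tau>) - f x\<bar> < 1" using R[of "-x"] by blast
    have "\<bar>f (x + \<tau>)\<bar> \<le> B" by (rule B) (use \<tau>(1) in auto)
    thus "\<bar>f x\<bar> \<le> B + 1" using \<tau>(2) by linarith
  qed
qed

section \<open>Monotone enumerations, counting and gaps\<close>

lemma mono_of_int_step:
  fixes a :: "int \<Rightarrow> real"
  assumes "\<forall>k. a k \<le> a (k + 1)" "i \<le> j"
  shows "a i \<le> a j"
  using assms(2) by (induction j rule: int_ge_induct) (use assms(1) order_trans in blast)+

text \<open>A bound on either side would trap infinitely many indices in one bounded
  interval.\<close>

lemma unbounded_enumeration: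
  fixes a :: "int \<Rightarrow> real"
  assumes mono: "\<And>i j. i \<le> j \<Longrightarrow> a i \<le> a j"
    and fin: "\<And>B. bounded B \<Longrightarrow> finite {k. a k \<in> B}"
  shows "\<exists>k. y \<le> a k" "\<exists>k. a k < y"
proof -
  show "\<exists>k. y \<le> a k"
  proof (rule ccontr)
    assume "\<not> ?thesis"
    hence "{0..} \<subseteq> {k. a k \<in> {a 0..y}}" using mono by (auto simp: not_le less_imp_le)
    thus False using fin[of "{a 0..y}", OF bounded_closed_interval] infinite_Ici finite_subset by blast
  qed
  show "\<exists>k. a k < y"
  proof (rule ccontr)
    assume "\<not> ?thesis"
    hence "{..0} \<subseteq> {k. a k \<in> {y..a 0}}" using mono by (auto simp: not_less)
    thus False using fin[of "{y..a 0}", OF bounded_closed_interval] infinite_Iic finite_subset by blast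
  qed
qed

text \<open>The last index below \<open>y\<close> acts as a counting function: its increment from
  \<open>y\<close> to \<open>z\<close> is the number of points in the half-open interval between
  them.\<close>

lemma ex_counting_index:
  fixes a :: "int \<Rightarrow> real"
  assumes mono: "\<And>i j. i \<le> j \<Longrightarrow> a i \<le> a j"
    and fin: "\<And>B. bounded B \<Longrightarrow> finite {k. a k \<in> B}"
  shows "\<exists>p. \<forall>k. a k < y \<longleftrightarrow> k \<le> p"
proof -
  obtain u v where u: "y \<le> a u" and v: "a v < y"
    using unbounded_enumeration[of a y] mono fin by blast
  let ?S = "{k. a k < y \<and> v \<le> k}"
  have "?S \<subseteq> {v..u}" using u mono by (smt (verit) atLeastAtMost_iff mem_Collect_eq subsetI)
  hence fS: "finite ?S" using finite_subset by blast
  have "v \<in> ?S" using v by simp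
  hence "a (Max ?S) < y" "v \<le> Max ?S" using Max_in[OF fS] by blast+
  moreover have "k \<le> Max ?S" if "a k < y" for k
    using that Max_ge[OF fS, of k] \<open>v \<le> Max ?S\<close> by (cases "v \<le> k") auto
  ultimately show ?thesis using mono by (metis le_less_trans)
qed

text \<open>After swapping the sums, each point contributes the value of a trapezoid. The two empty
  cells are exactly where it is fractional, so the contribution is 0 or 1, and 1 precisely for the
  indices in \<open>{p<..q}\<close>.\<close>

lemma sum_tents_between_gaps:
  fixes b :: "int \<Rightarrow> real"
  assumes \<delta>: "0 < \<delta>" and mn: "m \<le> n" and I: "finite I"
    and sub: "\<And>k. b k \<in> {of_int m * \<delta>..<of_int n * \<delta>} \<Longrightarrow> k \<in> I"
    and gap: "\<And>k. b k \<notin> {of_int m * \<delta>..<of_int (m + 1) * \<delta>}"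
      "\<And>k. b k \<notin> {of_int n * \<delta>..<of_int (n + 1) * \<delta>}"
    and p: "\<And>k. b k < of_int m * \<delta> \<longleftrightarrow> k \<le> p" and q: "\<And>k. b k < of_int n * \<delta> \<longleftrightarrow> k \<le> q"
  shows "(\<Sum>j\<in>{m<..n}. \<Sum>k\<in>I. tent \<delta> (b k - of_int j * \<delta>)) = of_int (q - p)"
proof -
  have mn': "of_int m * \<delta> \<le> of_int n * \<delta>" using mn \<delta> by simp
  have pq: "p \<le> q" using mn' p[of p] q[of p] by force
  have "(\<Sum>j\<in>{m<..n}. \<Sum>k\<in>I. tent \<delta> (b k - of_int j * \<delta>))
      = (\<Sum>k\<in>I. \<Sum>j\<in>{m<..n}. tent \<delta> (b k - of_int j * \<delta>))"
    by (rule sum.swap)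
  also have "\<dots> = (\<Sum>k\<in>I. of_bool (k \<in> {p<..q}))"
  proof (rule sum.cong[OF refl])
    fix k
    have "ramp \<delta> (b k - of_int m * \<delta>) = of_bool (of_int m * \<delta> \<le> b k)"
      using gap(1)[of k] by (subst ramp_outside[OF \<delta>]) (auto simp: algebra_simps)
    moreover have "ramp \<delta> (b k - of_int n * \<delta>) = of_bool (of_int n * \<delta> \<le> b k)"
      using gap(2)[of k] by (subst ramp_outside[OF \<delta>]) (auto simp: algebra_simps)
    ultimately show "(\<Sum>j\<in>{m<..n}. tent \<delta> (b k - of_int j * \<delta>)) = of_bool (k \<in> {p<..q})"
      using p[of k] q[of k] mn' pq by (subst sum_tent_telescope[OF \<delta> mn]) auto
  qed
  also have "\<dots> = real (card (I \<inter> {p<..q}))" using I by (simp add: of_bool_def sum.If_cases greaterThanAtMost_def greaterThan_def atMost_def Collect_conj_eq)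
  also have "I \<inter> {p<..q} = {p<..q}"
    using p q by (auto intro!: sub simp: not_less[symmetric])
  finally show ?thesis using pq by simp
qed

text \<open>Pigeonhole: each point lies in the single cell
  \<open>\<lfloor>s / \<delta>\<rfloor>\<close>, and there are more cells than points.\<close>

lemma ex_gap:
  fixes S :: "real set"
  assumes "0 < \<delta>" "finite S" "int (card S) < K"
  shows "\<exists>m\<in>{i..<i + K}. S \<inter> {of_int m * \<delta>..<of_int (m + 1) * \<delta>} = {}"
proof -
  let ?f = "\<lambda>s. \<lfloor>s / \<delta>\<rfloor>"
  have "int (card (?f ` S)) < K" using card_image_le[OF assms(2), of ?f] assms(3) by linarith
  moreover have "K \<le> int (card {i..<i + K})" by simp
  ultimately have "\<not> {i..<i + K} \<subseteq> ?f ` S"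
    using card_mono[of "?f ` S" "{i..<i + K}"] assms(2) by force
  then obtain m where m: "m \<in> {i..<i + K}" "m \<notin> ?f ` S" by blast
  have "?f s = m" if "s \<in> {of_int m * \<delta>..<of_int (m + 1) * \<delta>}" for s
    using that assms(1) by (intro floor_unique) (auto simp: field_simps)
  thus ?thesis using m by blast
qed

lemma int_shift_invariant_const:
  fixes f :: "int \<Rightarrow> 'a"
  assumes "\<And>n. f (n + 1) = f n"
  shows "f n = f 0"
proof (induction n rule: int_induct[where k = 0])
  case (step2 i)
  thus ?case using assms[of "i - 1"] by simp
qed (simp_all add: assms)

section \<open>From almost periods of tent sums to index translations\<close>

locale almost_periodic_enumeration =
  fixes A :: "real \<Rightarrow> nat" and a :: "int \<Rightarrow> real"
  assumes ap: "almost_periodic_mds A"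
    and enum: "enumerates a A"
    and step: "\<forall>k. a k \<le> a (k + 1)"
begin

lemma mds: "multiple_discrete_set A"
  using ap by (simp add: almost_periodic_mds_def)

lemma mono: "i \<le> j \<Longrightarrow> a i \<le> a j"
  by (rule mono_of_int_step[OF step])

lemma finite_bounded: "bounded B \<Longrightarrow> finite {k. a k \<in> B}"
  by (rule finite_enumerates_bounded[OF mds enum])

definition tent_sum :: "real \<Rightarrow> real \<Rightarrow> real" where
  "tent_sum \<delta> x = (\<integral>t. tent \<delta> (x + t) \<partial>mds_measure A)"

text \<open>Since the argument is added to \<open>t\<close> in \<open>tent_sum\<close>, evaluating
  at \<open>- y\<close> centres the tent at \<open>y\<close>.\<close>

lemma tent_sum_eq:
  assumes "0 < \<delta>" "finite I" "\<And>k. \<bar>a k - y\<bar> < \<delta> \<Longrightarrow> k \<in> I"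
  shows "tent_sum \<delta> (- y) = (\<Sum>k\<in>I. tent \<delta> (a k - y))"
proof -
  have "{t. tent \<delta> (- y + t) \<noteq> 0} \<subseteq> {y - \<delta>..y + \<delta>}"
  proof
    fix t assume "t \<in> {t. tent \<delta> (- y + t) \<noteq> 0}"
    hence "\<bar>- y + t\<bar> < \<delta>" using tent_eq_0[OF assms(1), of "- y + t"] by force
    thus "t \<in> {y - \<delta>..y + \<delta>}" by auto
  qed
  hence bdd: "bounded {t. tent \<delta> (- y + t) \<noteq> 0}" by (rule bounded_subset[OF bounded_closed_interval])
  have "(\<lambda>t. tent \<delta> (- y + t)) \<in> borel_measurable borel"
    by (intro borel_measurable_continuous_onI continuous_intros)
  from integral_mds_measure[OF mds enum this bdd assms(2)] assms(3) tent_eq_0[OF assms(1)]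
  show ?thesis unfolding tent_sum_def by (force simp: add.commute)
qed

lemma almost_periodic_tent_sum:
  assumes "0 < \<delta>"
  shows "almost_periodic (tent_sum \<delta>)"
proof -
  have "continuous_on UNIV (tent \<delta>)" by (intro continuous_intros)
  thus ?thesis
    using ap compactly_supported_tent[OF assms]
    unfolding almost_periodic_mds_def almost_periodic_measure_def tent_sum_def by blast
qed

text \<open>The tent of half-width 2 centred at \<open>x\<close> is at least 1/2 on the unit
  interval, so the count is at most twice a value of the bounded function
  \<open>tent_sum 2\<close>.\<close>

lemma bounded_count: "\<exists>M::nat. \<forall>x. card {k. a k \<in> {x..<x + 1}} \<le> M"
proof -
  obtain B where B: "\<And>x. \<bar>tent_sum 2 x\<bar> \<le> B"
    using almost_periodic_bounded[OF almost_periodic_tent_sum[of 2]] by auto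
  have "card {k. a k \<in> {x..<x + 1}} \<le> nat \<lceil>2 * B\<rceil>" for x
  proof -
    let ?J = "{k. a k \<in> {x..<x + 1}}" and ?I = "{k. a k \<in> {x - 2..x + 2}}"
    have fin: "finite ?I" using finite_bounded[OF bounded_closed_interval] .
    have "real (card ?J) * (1 / 2) = (\<Sum>k\<in>?J. 1 / 2)" by simp
    also have "\<dots> \<le> (\<Sum>k\<in>?J. tent 2 (a k - x))" by (rule sum_mono) (auto simp: tent_def)
    also have "\<dots> \<le> (\<Sum>k\<in>?I. tent 2 (a k - x))"
      by (rule sum_mono2[OF fin]) (auto simp: tent_nonneg)
    also have "\<dots> = tent_sum 2 (- x)" by (rule tent_sum_eq[symmetric]) (use fin in auto)
    also have "\<dots> \<le> B" using B[of "- x"] by simp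
    finally show ?thesis by linarith
  qed
  thus ?thesis by blast
qed

text \<open>Tents at consecutive multiples of \<open>\<delta>\<close> telescope, so between two indices whose cells contain no
  point of \<open>A\<close> or \<open>A + \<tau>\<close>, sums of \<open>tent_sum\<close> count points exactly. Such gaps are at most \<open>2 K\<close>
  indices apart, hence the counts for \<open>A\<close> and \<open>A + \<tau>\<close> differ by less than 1, i.e. agree.\<close>

lemma almost_period_imp_translation:
  assumes M: "\<And>x. card {k. a k \<in> {x..<x + 1}} \<le> M" and K: "K = 2 * int M + 1"
    and \<delta>: "0 < \<delta>" "of_int K * \<delta> \<le> 1"
    and \<tau>: "\<And>x. \<bar>tent_sum \<delta> (x + \<tau>) - tent_sum \<delta> x\<bar> < 1 / (2 * of_int K)"
  shows "\<exists>h. \<forall>k. \<bar>a (k + h) - a k - \<tau>\<bar> \<le> 2 * of_int K * \<delta>"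
proof -
  define b where "b = (\<lambda>k. a k + \<tau>)"
  define cell where "cell = (\<lambda>m. {of_int m * \<delta>..<of_int (m + 1) * \<delta>})"
  have Kpos: "0 < K" using K by simp
  \<comment> \<open>The \<open>K\<close> cells from index \<open>n * K\<close> on fit into a unit
    interval because \<open>K * \<delta> \<le> 1\<close>. It holds at most \<open>2 * M < K\<close>
    points of \<open>A\<close> and its translate together, so some cell is free of both.\<close>
  have "\<exists>g. n * K \<le> g \<and> g < (n + 1) * K \<and> (\<forall>k. a k \<notin> cell g) \<and> (\<forall>k. b k \<notin> cell g)" for n
  proof -
    define x where "x = of_int (n * K) * \<delta>"
    define S where "S = a ` {k. a k \<in> {x..<x + 1}} \<union> b ` {k. a k \<in> {x - \<tau>..<x - \<tau> + 1}}"
    have fin: "finite {k. a k \<in> {y..<y + 1}}" for y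
      by (rule finite_bounded) simp
    have "card S \<le> M + M"
      unfolding S_def
      by (intro order_trans[OF card_Un_le] add_mono order_trans[OF card_image_le] M fin)
    hence "int (card S) < K" using K by linarith
    moreover have "finite S" unfolding S_def using fin by blast
    ultimately obtain g where g: "g \<in> {n * K..<n * K + K}" "S \<inter> cell g = {}"
      using ex_gap[OF \<delta>(1), of S K "n * K"] unfolding cell_def by blast
    have "x \<le> of_int g * \<delta>" using g(1) \<delta>(1) unfolding x_def
      by (intro mult_right_mono) (auto simp del: of_int_mult)
    moreover have "of_int (g + 1) * \<delta> \<le> x + 1"
    proof -
      have "of_int (g + 1) * \<delta> \<le> of_int (n * K + K) * \<delta>"
        using g(1) \<delta>(1) by (intro mult_right_mono) (auto simp del: of_int_add of_int_mult)
      also have "\<dots> \<le> x + 1" using \<delta>(2) by (simp add: x_def algebra_simps)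
      finally show ?thesis .
    qed
    ultimately have sub: "cell g \<subseteq> {x..<x + 1}" unfolding cell_def by auto
    have "a k \<notin> cell g" for k
    proof
      assume c: "a k \<in> cell g"
      hence "a k \<in> S" using sub unfolding S_def by blast
      thus False using c g(2) by blast
    qed
    moreover have "b k \<notin> cell g" for k
    proof
      assume c: "b k \<in> cell g"
      hence "a k \<in> {x - \<tau>..<x - \<tau> + 1}" using sub by (force simp: b_def)
      hence "b k \<in> S" unfolding S_def by blast
      thus False using c g(2) by blast
    qed
    ultimately show ?thesis using g(1) by (auto simp: algebra_simps)
  qed
  then obtain g where g: "\<And>n. n * K \<le> g n" "\<And>n. g n < (n + 1) * K"
    "\<And>n k. a k \<notin> cell (g n)" "\<And>n k. b k \<notin> cell (g n)"
    by metis
  have "\<forall>y. \<exists>p. \<forall>k. a k < y \<longleftrightarrow> k \<le> p"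
    using ex_counting_index[of a] mono finite_bounded by blast
  then obtain P where P: "\<And>y k. a k < y \<longleftrightarrow> k \<le> P y" by metis
  have Q: "b k < y \<longleftrightarrow> k \<le> P (y - \<tau>)" for y k
    unfolding P[symmetric] b_def by auto
  define Y where "Y = (\<lambda>n. of_int (g n) * \<delta>)"
  \<comment> \<open>The lead of the counting index of \<open>A\<close> over that of its translate at
    the gap point \<open>Y n\<close>.\<close>
  define h where "h = (\<lambda>n. P (Y n) - P (Y n - \<tau>))"
  have "h (n + 1) = h n" for n
  proof -
    have "g n < (n + 1) * K" "(n + 1) * K \<le> g (n + 1)" using g(2)[of n] g(1)[of "n + 1"] .
    hence le: "g n \<le> g (n + 1)" by linarith
    have "g (n + 1) - g n < 2 * K" using g(2)[of "n + 1"] g(1)[of n] by (simp add: algebra_simps)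
    hence lt: "real_of_int (g (n + 1) - g n) < 2 * of_int K" by linarith
    define J where "J = {g n<..g (n + 1)}"
    \<comment> \<open>The margin \<delta> on both sides captures every point under a tent centred
      between the gaps; the second set does the same for the translated points
      \<open>b k\<close>.\<close>
    define I where "I = {k. a k \<in> {Y n - \<delta>..Y (n + 1) + \<delta>}} \<union> {k. a k \<in> {Y n - \<delta> - \<tau>..Y (n + 1) + \<delta> - \<tau>}}"
    have fin: "finite I" unfolding I_def using finite_bounded[OF bounded_closed_interval] by blast
    have inJ: "Y n \<le> of_int j * \<delta>" "of_int j * \<delta> \<le> Y (n + 1)" if "j \<in> J" for j
      using that \<delta>(1) unfolding J_def Y_def by auto
    have A_sum: "(\<Sum>j\<in>J. \<Sum>k\<in>I. tent \<delta> (a k - of_int j * \<delta>)) = of_int (P (Y (n + 1)) - P (Y n))"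
      unfolding J_def
    proof (rule sum_tents_between_gaps[OF \<delta>(1) le fin])
      fix k assume "a k \<in> {of_int (g n) * \<delta>..<of_int (g (n + 1)) * \<delta>}"
      thus "k \<in> I" using \<delta>(1) by (auto simp: I_def Y_def)
    qed (use g(3)[of _ n] g(3)[of _ "n + 1"] P in \<open>auto simp: cell_def Y_def simp del: of_int_add\<close>)
    have B_sum: "(\<Sum>j\<in>J. \<Sum>k\<in>I. tent \<delta> (b k - of_int j * \<delta>))
        = of_int (P (Y (n + 1) - \<tau>) - P (Y n - \<tau>))"
      unfolding J_def
    proof (rule sum_tents_between_gaps[OF \<delta>(1) le fin])
      fix k assume "b k \<in> {of_int (g n) * \<delta>..<of_int (g (n + 1)) * \<delta>}"
      thus "k \<in> I" using \<delta>(1) by (auto simp: I_def Y_def b_def)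
    qed (use g(4)[of _ n] g(4)[of _ "n + 1"] Q in \<open>auto simp: cell_def Y_def simp del: of_int_add\<close>)
    have A_F: "(\<Sum>k\<in>I. tent \<delta> (a k - of_int j * \<delta>)) = tent_sum \<delta> (- (of_int j * \<delta>))" if "j \<in> J" for j
      using inJ[OF that] by (intro tent_sum_eq[symmetric] \<delta>(1) fin) (auto simp: I_def)
    have B_F: "(\<Sum>k\<in>I. tent \<delta> (b k - of_int j * \<delta>)) = tent_sum \<delta> (- (of_int j * \<delta>) + \<tau>)" if "j \<in> J" for j
    proof -
      have "tent_sum \<delta> (- (of_int j * \<delta> - \<tau>)) = (\<Sum>k\<in>I. tent \<delta> (a k - (of_int j * \<delta> - \<tau>)))"
        using inJ[OF that] by (intro tent_sum_eq \<delta>(1) fin) (auto simp: I_def)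
      thus ?thesis by (simp add: b_def algebra_simps)
    qed
    have "\<bar>of_int (h n - h (n + 1))\<bar> = \<bar>\<Sum>j\<in>J. tent_sum \<delta> (- (of_int j * \<delta>) + \<tau>) - tent_sum \<delta> (- (of_int j * \<delta>))\<bar>"
      using A_sum B_sum A_F B_F by (simp add: h_def sum_subtractf)
    also have "\<dots> \<le> (\<Sum>j\<in>J. \<bar>tent_sum \<delta> (- (of_int j * \<delta>) + \<tau>) - tent_sum \<delta> (- (of_int j * \<delta>))\<bar>)"
      by (rule sum_abs)
    also have "\<dots> \<le> (\<Sum>j\<in>J. 1 / (2 * of_int K))"
      by (rule sum_mono) (use \<tau> less_imp_le in blast)
    also have "\<dots> = real_of_int (g (n + 1) - g n) / (2 * of_int K)"
      using le by (simp add: J_def)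
    also have "\<dots> < 1" using lt Kpos by (simp add: field_simps)
    finally have "\<bar>h n - h (n + 1)\<bar> < 1" by linarith
    thus ?thesis by linarith
  qed
  hence h: "h n = h 0" for n by (rule int_shift_invariant_const)
  \<comment> \<open>No gap point separates \<open>b k\<close> from \<open>a (k + h 0)\<close>, so
    their distance is controlled by the spacing of the gap points.\<close>
  have key: "b k < Y n \<longleftrightarrow> a (k + h 0) < Y n" for k n
    unfolding P Q h[of n, symmetric] by (auto simp: h_def)
  \<comment> \<open>The first multiple of \<open>w = K * \<delta>\<close> beyond \<open>u\<close> is
    at most \<open>u + w\<close>, and the gap point of that block follows within less than another
    \<open>w\<close>.\<close>
  have dense: "\<exists>n. u < Y n \<and> Y n < u + 2 * of_int K * \<delta>" for u
  proof -
    define w where "w = of_int K * \<delta>"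
    have w: "0 < w" using Kpos \<delta>(1) by (simp add: w_def)
    define n where "n = \<lfloor>u / w\<rfloor> + 1"
    have "of_int n - 1 \<le> u / w" "u / w < of_int n" unfolding n_def by linarith+
    hence n: "of_int n * w \<le> u + w" "u < of_int n * w" using w by (simp_all add: field_simps)
    have "of_int (n * K) * \<delta> \<le> Y n" "Y n < of_int ((n + 1) * K) * \<delta>"
      unfolding Y_def using g(1,2)[of n] \<delta>(1)
      by (simp_all del: of_int_mult of_int_add)
    thus ?thesis using n by (intro exI[of _ n]) (auto simp: w_def algebra_simps)
  qed
  have "\<bar>a (k + h 0) - a k - \<tau>\<bar> \<le> 2 * of_int K * \<delta>" for k
  proof -
    \<comment> \<open>The gap point just above \<open>b k\<close> also lies above
      \<open>a (k + h 0)\<close>; exchanging the roles gives the other inequality.\<close>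
    obtain n where "b k < Y n" "Y n < b k + 2 * of_int K * \<delta>" using dense by blast
    moreover obtain m where "a (k + h 0) < Y m" "Y m < a (k + h 0) + 2 * of_int K * \<delta>"
      using dense by blast
    ultimately show ?thesis using key[of k n] key[of k m] by (auto simp: b_def abs_le_iff)
  qed
  thus ?thesis by blast
qed

text \<open>Almost periodicity transferred to the enumeration: for relatively dense \<tau>,
  translating by \<tau> amounts to reindexing, up to \<epsilon>.\<close>

lemma ex_translations:
  assumes "0 < \<epsilon>"
  shows "\<exists>R. \<forall>c. \<exists>\<tau> h. \<bar>\<tau> - c\<bar> < R \<and> (\<forall>k. \<bar>a (k + h) - a k - \<tau>\<bar> \<le> \<epsilon>)"
proof -
  obtain M where M: "\<And>x. card {k. a k \<in> {x..<x + 1}} \<le> M" using bounded_count by blast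
  define K where "K = 2 * int M + 1"
  have K: "0 < real_of_int K" by (simp add: K_def)
  \<comment> \<open>The first bound lets \<open>K\<close> cells fit into a unit interval, the second
    turns the error \<open>2 * K * \<delta>\<close> into at most \<epsilon>.\<close>
  define \<delta> where "\<delta> = min (1 / of_int K) (\<epsilon> / (2 * of_int K))"
  have \<delta>: "0 < \<delta>" using K assms by (simp add: \<delta>_def)
  have "\<delta> \<le> 1 / of_int K" "\<delta> \<le> \<epsilon> / (2 * of_int K)" by (simp_all add: \<delta>_def)
  hence \<delta>1: "of_int K * \<delta> \<le> 1" and \<delta>2: "2 * of_int K * \<delta> \<le> \<epsilon>"
    using K by (simp_all add: field_simps)
  obtain R where R: "\<And>c. \<exists>\<tau>. \<bar>\<tau> - c\<bar> < R \<and> (\<forall>x. \<bar>tent_sum \<delta> (x + \<tau>) - tent_sum \<delta> x\<bar> < 1 / (2 * of_int K))"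
    using almost_periodicD[OF almost_periodic_tent_sum[OF \<delta>], of "1 / (2 * of_int K)"] K by auto
  show ?thesis
  proof (rule exI[of _ R], rule allI)
    fix c
    obtain \<tau> where \<tau>: "\<bar>\<tau> - c\<bar> < R" "\<And>x. \<bar>tent_sum \<delta> (x + \<tau>) - tent_sum \<delta> x\<bar> < 1 / (2 * of_int K)"
      using R by blast
    obtain h where "\<And>k. \<bar>a (k + h) - a k - \<tau>\<bar> \<le> 2 * of_int K * \<delta>"
      using almost_period_imp_translation[OF M K_def \<delta> \<delta>1 \<tau>(2)] by blast
    thus "\<exists>\<tau> h. \<bar>\<tau> - c\<bar> < R \<and> (\<forall>k. \<bar>a (k + h) - a k - \<tau>\<bar> \<le> \<epsilon>)"
      using \<tau>(1) \<delta>2 order_trans by blast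
  qed
qed


end

section \<open>The common slope of all approximate translations\<close>

text \<open>The error grows only linearly in \<open>n\<close>, so the error per step stays
  \<epsilon>.\<close>

lemma translation_iterate:
  fixes a :: "int \<Rightarrow> real"
  assumes "\<And>k. \<bar>a (k + h) - a k - \<tau>\<bar> \<le> \<epsilon>"
  shows "\<bar>a (k + int n * h) - a k - real n * \<tau>\<bar> \<le> real n * \<epsilon>"
proof (induction n)
  case (Suc n)
  have "k + int (Suc n) * h = (k + int n * h) + h" by (simp add: algebra_simps)
  thus ?case using Suc.IH assms[of "k + int n * h"] by (simp only: of_nat_Suc distrib_right)
qed simp

text \<open>\<open>L\<close> is a mean spacing: one number fits all approximate translations at
  once, without loss in the error.\<close>

definition translation_slope :: "(int \<Rightarrow> real) \<Rightarrow> real \<Rightarrow> bool" where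
  "translation_slope a L \<longleftrightarrow>
    (\<forall>\<epsilon> \<tau> h. (\<forall>k. \<bar>a (k + h) - a k - \<tau>\<bar> \<le> \<epsilon>) \<longrightarrow> \<bar>\<tau> - of_int h * L\<bar> \<le> \<epsilon>)"

lemma translation_slopeD:
  "translation_slope a L \<Longrightarrow> (\<And>k. \<bar>a (k + h) - a k - \<tau>\<bar> \<le> \<epsilon>) \<Longrightarrow> \<bar>\<tau> - of_int h * L\<bar> \<le> \<epsilon>"
  by (simp add: translation_slope_def)

text \<open>Comparing \<open>h'\<close> steps of a translation \<open>(h, \<tau>)\<close> with \<open>h\<close> steps of \<open>(h', \<tau>')\<close> shows that the
  intervals with end points \<open>(\<tau> \<plusminus> \<epsilon>) / h\<close> intersect pairwise, hence have a common point.\<close>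

lemma ex_slope:   shows "\<exists>L. translation_slope a L"
proof -
  define T where "T = (\<lambda>\<epsilon> \<tau> h. \<forall>k. \<bar>a (k + h) - a k - \<tau>\<bar> \<le> \<epsilon>)"
  \<comment> \<open>The left end points for positive \<open>h\<close>. By \<open>cross\<close> every
    right end point bounds \<open>S\<close> above, so \<open>Sup S\<close> lies in all the
    intervals.\<close>
  define S where "S = {(\<tau> - \<epsilon>) / of_int h | \<epsilon> \<tau> h. T \<epsilon> \<tau> h \<and> 0 < h}"
  have cross: "(\<tau> - \<epsilon>) / of_int h \<le> (\<tau>' + \<epsilon>') / of_int h'"
    if "T \<epsilon> \<tau> h" "T \<epsilon>' \<tau>' h'" "0 < h" "0 < h'" for \<epsilon> \<tau> h \<epsilon>' \<tau>' h'
  proof -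
    have h: "real (nat h) = of_int h" "int (nat h) = h" "real (nat h') = of_int h'" "int (nat h') = h'"
      using that by auto
    have "\<bar>a (0 + h' * h) - a 0 - of_int h' * \<tau>\<bar> \<le> of_int h' * \<epsilon>"
      using translation_iterate[of a h \<tau> \<epsilon> 0 "nat h'"] that(1) h by (simp add: T_def)
    moreover have "\<bar>a (0 + h * h') - a 0 - of_int h * \<tau>'\<bar> \<le> of_int h * \<epsilon>'"
      using translation_iterate[of a h' \<tau>' \<epsilon>' 0 "nat h"] that(2) h by (simp add: T_def)
    ultimately have "of_int h' * (\<tau> - \<epsilon>) \<le> of_int h * (\<tau>' + \<epsilon>')"
      by (simp add: mult.commute[of h h'] abs_le_iff algebra_simps)
    thus ?thesis using that by (simp add: field_simps)
  qed
  have pos: "\<bar>\<tau> - of_int h * Sup S\<bar> \<le> \<epsilon>" if "T \<epsilon> \<tau> h" "0 < h" for \<epsilon> \<tau> h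
  proof -
    have upper: "s \<le> (\<tau> + \<epsilon>) / of_int h" if "s \<in> S" for s
      using that cross \<open>T \<epsilon> \<tau> h\<close> \<open>0 < h\<close> unfolding S_def by blast
    have mem: "(\<tau> - \<epsilon>) / of_int h \<in> S" using that unfolding S_def by blast
    have "(\<tau> - \<epsilon>) / of_int h \<le> Sup S"
      by (rule cSup_upper[OF mem]) (use upper in \<open>rule bdd_aboveI\<close>)
    moreover have "Sup S \<le> (\<tau> + \<epsilon>) / of_int h"
      by (rule cSup_least) (use mem upper in blast)+
    ultimately show ?thesis using that(2) by (simp add: field_simps abs_le_iff)
  qed
  have "\<bar>\<tau> - of_int h * Sup S\<bar> \<le> \<epsilon>" if "T \<epsilon> \<tau> h" for \<epsilon> \<tau> h
  proof (cases h "0 :: int" rule: linorder_cases)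
    \<comment> \<open>Read backwards from \<open>k - h\<close>, the translation becomes one by
      \<open>- h\<close> and \<open>- \<tau>\<close> with the same error.\<close>
    case less
    have "T \<epsilon> (- \<tau>) (- h)"
      unfolding T_def
    proof
      fix k
      have "\<bar>a (k - h + h) - a (k - h) - \<tau>\<bar> \<le> \<epsilon>" using that unfolding T_def by blast
      thus "\<bar>a (k + - h) - a k - - \<tau>\<bar> \<le> \<epsilon>" by (simp add: abs_le_iff)
    qed
    from pos[OF this] less show ?thesis by (simp add: abs_le_iff)
  next
    case equal
    thus ?thesis using that by (simp add: T_def)
  next
    case greater
    thus ?thesis using pos that by blast
  qed
  thus ?thesis unfolding T_def translation_slope_def by blast
qed

section \<open>Piecewise linear interpolation of almost periodic sequences\<close>

definition interpolate :: "(int \<Rightarrow> real) \<Rightarrow> real \<Rightarrow> real" where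
  "interpolate g x = (1 - frac x) * g \<lfloor>x\<rfloor> + frac x * g (\<lfloor>x\<rfloor> + 1)"

lemma interpolate_of_int: "interpolate g (of_int k) = g k"
  by (simp add: interpolate_def)

lemma continuous_on_interpolate: "continuous_on UNIV (interpolate g)"
proof -
  have "isCont (interpolate g) x" for x
  proof -
    define n where "n = \<lfloor>x\<rfloor>"
    \<comment> \<open>One formula valid on both sides of the node \<open>n\<close>: the
      \<open>max\<close> term is active to its right, the \<open>min\<close> term to its left. This
      avoids the jumps of the floor function.\<close>
    let ?G = "\<lambda>y. g n + max 0 (y - of_int n) * (g (n + 1) - g n) + min 0 (y - of_int n) * (g n - g (n - 1))"
    have "interpolate g y = ?G y" if "y \<in> {of_int n - 1<..<of_int n + 1}" for y
    proof (cases "of_int n \<le> y")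
      case True
      hence "\<lfloor>y\<rfloor> = n" using that by (intro floor_unique) auto
      thus ?thesis using True by (simp add: interpolate_def frac_def algebra_simps)
    next
      case False
      have fl: "\<lfloor>y\<rfloor> = n - 1" using that False by (intro floor_unique) auto
      show ?thesis using False by (simp add: interpolate_def frac_def fl algebra_simps)
    qed
    moreover have "x \<in> {of_int n - 1<..<of_int n + 1}" unfolding n_def by (simp, linarith)
    ultimately have "eventually (\<lambda>y. interpolate g y = ?G y) (nhds x)"
      by (intro eventually_nhds[THEN iffD2] exI[of _ "{of_int n - 1<..<of_int n + 1}"]) auto
    moreover have "isCont ?G x" by (intro continuous_intros)
    ultimately show ?thesis by (subst isCont_cong)
  qed
  thus ?thesis by (simp add: continuous_at_imp_continuous_on)
qed

text \<open>An integer shift preserves the fractional part, so the difference is a convex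
  combination of two differences of \<open>g\<close>.\<close>

lemma interpolate_shift:
  assumes "\<And>k. \<bar>g (k + h) - g k\<bar> \<le> \<epsilon>"
  shows "\<bar>interpolate g (x + of_int h) - interpolate g x\<bar> \<le> \<epsilon>"
proof -
  let ?u = "g (\<lfloor>x\<rfloor> + h) - g \<lfloor>x\<rfloor>" and ?v = "g (\<lfloor>x\<rfloor> + 1 + h) - g (\<lfloor>x\<rfloor> + 1)"
  have "frac (x + of_int h) = frac x" "\<lfloor>x + of_int h\<rfloor> = \<lfloor>x\<rfloor> + h" by (simp_all add: frac_def)
  hence "interpolate g (x + of_int h) - interpolate g x = (1 - frac x) * ?u + frac x * ?v"
    by (simp add: interpolate_def algebra_simps)
  also have "\<bar>\<dots>\<bar> \<le> (1 - frac x) * \<bar>?u\<bar> + frac x * \<bar>?v\<bar>"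
    using frac_lt_1[of x] frac_ge_0[of x]
    by (intro order_trans[OF abs_triangle_ineq]) (simp add: abs_mult)
  also have "\<dots> \<le> (1 - frac x) * \<epsilon> + frac x * \<epsilon>"
    using frac_lt_1[of x] frac_ge_0[of x] assms by (intro add_mono mult_left_mono) auto
  finally show ?thesis by (simp add: algebra_simps)
qed

lemma almost_periodic_interpolate:
  assumes "\<And>\<epsilon>. 0 < \<epsilon> \<Longrightarrow> \<exists>R. \<forall>c :: real. \<exists>h. \<bar>of_int h - c\<bar> < R \<and> (\<forall>k. \<bar>g (k + h) - g k\<bar> \<le> \<epsilon>)"
  shows "almost_periodic (interpolate g)"
  unfolding almost_periodic_def relatively_dense_def
proof (intro conjI allI impI continuous_on_interpolate)
  fix \<epsilon> :: real assume "0 < \<epsilon>"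
  \<comment> \<open>A supremum inherits only the non-strict bound; \<epsilon> / 2 leaves room for
    the strict one.\<close>
  then obtain R where R: "\<And>c :: real. \<exists>h. \<bar>of_int h - c\<bar> < R \<and> (\<forall>k. \<bar>g (k + h) - g k\<bar> \<le> \<epsilon> / 2)"
    using assms[of "\<epsilon> / 2"] by auto
  show "\<exists>R. \<forall>c. {\<tau>. (SUP x. ereal \<bar>interpolate g (x + \<tau>) - interpolate g x\<bar>) < ereal \<epsilon>}
      \<inter> {c - R<..<c + R} \<noteq> {}"
  proof (rule exI[of _ R], rule allI)
    fix c
    obtain h where h: "\<bar>of_int h - c\<bar> < R" "\<And>k. \<bar>g (k + h) - g k\<bar> \<le> \<epsilon> / 2" using R by blast
    have "(SUP x. ereal \<bar>interpolate g (x + of_int h) - interpolate g x\<bar>) \<le> ereal (\<epsilon> / 2)"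
      by (rule SUP_least) (simp only: ereal_less_eq(3) interpolate_shift[of g h "\<epsilon> / 2", OF h(2)])
    also have "\<dots> < ereal \<epsilon>" using \<open>0 < \<epsilon>\<close> by simp
    finally have "of_int h \<in> {\<tau>. (SUP x. ereal \<bar>interpolate g (x + \<tau>) - interpolate g x\<bar>) < ereal \<epsilon>}"
      by simp
    moreover have "of_int h \<in> {c - R<..<c + R}" using h(1) by (simp add: abs_less_iff)
    ultimately show "{\<tau>. (SUP x. ereal \<bar>interpolate g (x + \<tau>) - interpolate g x\<bar>) < ereal \<epsilon>}
      \<inter> {c - R<..<c + R} \<noteq> {}" by blast
  qed
qed

section \<open>Identification of the density and conclusion\<close>

lemma card_between_reals:
  fixes u v :: real
  shows "finite {k. u < of_int k \<and> of_int k < v}"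
    and "u \<le> v \<Longrightarrow> \<bar>real (card {k. u < of_int k \<and> of_int k < v}) - (v - u)\<bar> \<le> 1"
proof -
  have eq: "{k. u < of_int k \<and> of_int k < v} = {\<lfloor>u\<rfloor><..<\<lceil>v\<rceil>}"
    by (auto simp: floor_less_iff less_ceiling_iff)
  show "finite {k. u < of_int k \<and> of_int k < v}" unfolding eq by simp
  assume "u \<le> v"
  \<comment> \<open>Truncation by \<open>nat\<close> matters only when \<open>u = v\<close> is an
    integer, where the difference is -1.\<close>
  have card: "card {k. u < of_int k \<and> of_int k < v} = nat (\<lceil>v\<rceil> - (\<lfloor>u\<rfloor> + 1))"
    unfolding eq by simp
  show "\<bar>real (card {k. u < of_int k \<and> of_int k < v}) - (v - u)\<bar> \<le> 1"
    unfolding card using \<open>u \<le> v\<close> by linarith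
qed

context almost_periodic_enumeration
begin

text \<open>A translation with error 1 and \<tau> > 1 moves \<open>a 0\<close> strictly to the
  right. Monotonicity then forces \<open>h > 0\<close>, and
  \<open>h * L \<ge> \<tau> - 1 > 0\<close>.\<close>

lemma slope_pos:
  assumes L: "translation_slope a L"
  shows "0 < L"
proof -
  obtain R where R: "\<And>c. \<exists>\<tau> h. \<bar>\<tau> - c\<bar> < R \<and> (\<forall>k. \<bar>a (k + h) - a k - \<tau>\<bar> \<le> 1)"
    using ex_translations[of 1] by auto
  obtain \<tau> h where \<tau>: "\<bar>\<tau> - (R + 1)\<bar> < R" "\<And>k. \<bar>a (k + h) - a k - \<tau>\<bar> \<le> 1" using R by blast
  have "a 0 < a (0 + h)" using \<tau>(1) \<tau>(2)[of 0] by linarith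
  hence "0 < h" using mono[of h 0] by force
  moreover have "0 < of_int h * L" using translation_slopeD[OF L \<tau>(2)] \<tau>(1) by linarith
  ultimately show ?thesis by (simp add: zero_less_mult_iff)
qed

text \<open>The deviation changes by \<open>(a (k + h) - a k - \<tau>) + (\<tau> - h * L)\<close>,
  each part at most \<epsilon> / 2. Choosing \<tau> near \<open>c * L\<close> places
  \<open>h\<close> near \<open>c\<close>.\<close>

lemma index_translations:
  assumes L: "translation_slope a L"
    and "0 < \<epsilon>"
  shows "\<exists>R. \<forall>c :: real. \<exists>h. \<bar>of_int h - c\<bar> < R \<and>
    (\<forall>k. \<bar>(a (k + h) - of_int (k + h) * L) - (a k - of_int k * L)\<bar> \<le> \<epsilon>)"
proof -
  have Lp: "0 < L" by (rule slope_pos[OF L])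
  obtain R where R: "\<And>c. \<exists>\<tau> h. \<bar>\<tau> - c\<bar> < R \<and> (\<forall>k. \<bar>a (k + h) - a k - \<tau>\<bar> \<le> \<epsilon> / 2)"
    using ex_translations[of "\<epsilon> / 2"] assms(2) by auto
  show ?thesis
  proof (rule exI[of _ "(R + \<epsilon>) / L"], rule allI)
    fix c :: real
    obtain \<tau> h where \<tau>: "\<bar>\<tau> - c * L\<bar> < R" "\<And>k. \<bar>a (k + h) - a k - \<tau>\<bar> \<le> \<epsilon> / 2" using R by blast
    have hL: "\<bar>\<tau> - of_int h * L\<bar> \<le> \<epsilon> / 2" by (rule translation_slopeD[OF L \<tau>(2)])
    have "\<bar>of_int h - c\<bar> * L = \<bar>of_int h * L - c * L\<bar>"
      using Lp by (simp add: abs_mult left_diff_distrib[symmetric])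
    also have "\<dots> < R + \<epsilon>" using hL \<tau>(1) assms(2) by linarith
    finally have "\<bar>of_int h - c\<bar> < (R + \<epsilon>) / L" using Lp by (simp add: field_simps)
    moreover have "\<bar>(a (k + h) - of_int (k + h) * L) - (a k - of_int k * L)\<bar> \<le> \<epsilon>" for k
    proof -
      have "(a (k + h) - of_int (k + h) * L) - (a k - of_int k * L) = (a (k + h) - a k - \<tau>) + (\<tau> - of_int h * L)"
        by (simp add: algebra_simps)
      thus ?thesis using \<tau>(2)[of k] hL by linarith
    qed
    ultimately show "\<exists>h. \<bar>of_int h - c\<bar> < (R + \<epsilon>) / L \<and>
      (\<forall>k. \<bar>(a (k + h) - of_int (k + h) * L) - (a k - of_int k * L)\<bar> \<le> \<epsilon>)" by blast
  qed
qed

text \<open>The indices of points in a window lie between those with \<open>k * L\<close> in the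
  window shrunk by \<open>C\<close> and in the window enlarged by \<open>C\<close>. Counting
  integers gives \<open>2 * (R - C) / L - 1\<close> and \<open>2 * (R + C) / L + 1\<close>; division
  by \<open>2 * R\<close> leaves the error \<open>(C / L + 1 / 2) / R\<close>.\<close>

lemma density_eq:
  assumes Lp: "0 < L" and C: "\<And>k. \<bar>a k - of_int k * L\<bar> \<le> C"
  shows "mds_density A = 1 / L"
proof -
  have lim: "((\<lambda>R. real (mds_card A {x - R<..<x + R}) / (2 * R)) \<longlongrightarrow> 1 / L) at_top" for x
  proof (rule tendsto_sandwich)
    have inv0: "((\<lambda>R. (C / L + 1 / 2) / R) \<longlongrightarrow> 0) at_top"
      by (rule tendsto_divide_0[OF tendsto_const filterlim_at_top_imp_at_infinity[OF filterlim_ident]])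
    have C0: "0 \<le> C" using C[of 0] by linarith
    let ?B = "\<lambda>u v. {k. u / L < of_int k \<and> of_int k < v / L}"
    have ev: "1 / L - (C / L + 1 / 2) / R \<le> real (mds_card A {x - R<..<x + R}) / (2 * R)
      \<and> real (mds_card A {x - R<..<x + R}) / (2 * R) \<le> 1 / L + (C / L + 1 / 2) / R"
      if "C < R" for R
    proof -
      let ?E = "{k. a k \<in> {x - R<..<x + R}}"
      have E: "mds_card A {x - R<..<x + R} = card ?E"
        by (rule mds_card_enumerates[OF mds enum]) simp
      have "?B (x - R + C) (x + R - C) \<subseteq> ?E"
      proof
        fix k assume "k \<in> ?B (x - R + C) (x + R - C)"
        hence "x - R + C < of_int k * L" "of_int k * L < x + R - C" using Lp by (auto simp: field_simps)
        thus "k \<in> ?E" using C[of k] by auto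
      qed
      hence "card (?B (x - R + C) (x + R - C)) \<le> card ?E"
        by (intro card_mono finite_bounded) auto
      \<comment> \<open>Here \<open>C < R\<close> keeps the end points of the shrunken window in
        order.\<close>
      moreover have "(x - R + C) / L \<le> (x + R - C) / L"
        using Lp that by (intro divide_right_mono) auto
      from card_between_reals(2)[OF this]
      have "(x + R - C) / L - (x - R + C) / L - 1 \<le> card (?B (x - R + C) (x + R - C))" by linarith
      ultimately have lower: "2 * (R - C) / L - 1 \<le> real (card ?E)"
        by (simp add: diff_divide_distrib add_divide_distrib)
      have "?E \<subseteq> ?B (x - R - C) (x + R + C)"
      proof
        fix k assume "k \<in> ?E"
        hence "x - R - C < of_int k * L" "of_int k * L < x + R + C" using C[of k] by auto
        thus "k \<in> ?B (x - R - C) (x + R + C)" using Lp by (auto simp: field_simps)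
      qed
      hence "card ?E \<le> card (?B (x - R - C) (x + R + C))"
        by (intro card_mono card_between_reals(1))
      moreover have "(x - R - C) / L \<le> (x + R + C) / L"
        using Lp that C0 by (intro divide_right_mono) auto
      from card_between_reals(2)[OF this]
      have "card (?B (x - R - C) (x + R + C)) \<le> (x + R + C) / L - (x - R - C) / L + 1" by linarith
      ultimately have upper: "real (card ?E) \<le> 2 * (R + C) / L + 1"
        by (simp add: diff_divide_distrib add_divide_distrib)
      have R: "0 < R" using that C0 by simp
      have "1 / L - (C / L + 1 / 2) / R = (2 * (R - C) / L - 1) / (2 * R)"
        "1 / L + (C / L + 1 / 2) / R = (2 * (R + C) / L + 1) / (2 * R)"
        using R Lp by (simp_all add: field_simps)
      thus ?thesis unfolding E using lower upper R
        by (simp only:) (intro conjI divide_right_mono, auto)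
    qed
    show "\<forall>\<^sub>F R in at_top. 1 / L - (C / L + 1 / 2) / R \<le> real (mds_card A {x - R<..<x + R}) / (2 * R)"
      using eventually_gt_at_top[of C] by eventually_elim (use ev in blast)
    show "\<forall>\<^sub>F R in at_top. real (mds_card A {x - R<..<x + R}) / (2 * R) \<le> 1 / L + (C / L + 1 / 2) / R"
      using eventually_gt_at_top[of C] by eventually_elim (use ev in blast)
    show "((\<lambda>R. 1 / L - (C / L + 1 / 2) / R) \<longlongrightarrow> 1 / L) at_top"
      using tendsto_diff[OF tendsto_const inv0] by simp
    show "((\<lambda>R. 1 / L + (C / L + 1 / 2) / R) \<longlongrightarrow> 1 / L) at_top" 
      using tendsto_add[OF tendsto_const inv0] by simp
  qed
  show ?thesis
    unfolding mds_density_def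
  \<comment> \<open>The density is a definite description, so uniqueness must be shown too;
    comparing the limits at \<open>x = 0\<close> does it.\<close>
  proof (rule the_equality)
    show "\<forall>x. ((\<lambda>R. real (mds_card A {x - R<..<x + R}) / (2 * R)) \<longlongrightarrow> 1 / L) at_top"
      using lim by blast
    show "D = 1 / L" if "\<forall>x. ((\<lambda>R. real (mds_card A {x - R<..<x + R}) / (2 * R)) \<longlongrightarrow> D) at_top" for D
      using tendsto_unique[OF trivial_limit_at_top_linorder that[rule_format, of 0] lim[of 0]] .
  qed
qed

lemma ex_almost_periodic_deviation:
  "\<exists>f. almost_periodic f \<and> (\<forall>k. a k = of_int k / mds_density A + f (of_int k))"
proof -
  obtain L where L: "translation_slope a L"
    using ex_slope[of a] by blast
  define g where "g = (\<lambda>k. a k - of_int k * L)"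
  have ap: "almost_periodic (interpolate g)"
    using index_translations[OF L] by (intro almost_periodic_interpolate) (simp add: g_def)
  then obtain C where "\<And>x. \<bar>interpolate g x\<bar> \<le> C" using almost_periodic_bounded by blast
  hence "\<bar>a k - of_int k * L\<bar> \<le> C" for k using interpolate_of_int[of g k] unfolding g_def by metis
  hence "mds_density A = 1 / L" by (rule density_eq[OF slope_pos[OF L]])
  thus ?thesis
    using ap by (intro exI[of _ "interpolate g"]) (simp add: interpolate_of_int g_def)
qed

end

theorem theorem4:
  fixes A :: "real \<Rightarrow> nat" and a :: "int \<Rightarrow> real" and D :: real
  assumes "almost_periodic_mds A"
    and "enumerates a A"
    and "\<forall>k. a k \<le> a (k + 1)"
    and "D = mds_density A"
  shows "\<exists>f. almost_periodic f \<and> (\<forall>k. a k = of_int k / D + f (of_int k))"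
proof -
  interpret almost_periodic_enumeration A a by unfold_locales (fact assms)+
  show ?thesis unfolding assms(4) by (rule ex_almost_periodic_deviation)
qed

end
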